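(* Let $(\Omega,\mathcal{A},\pi)$ be a probability space and let $\mathcal{I}\subseteq\mathcal{A}$ be a system of measurable sets. Define \[ \overline{H}_{\mathrm{fin}}(\mathcal{I},\pi) = \inf_{a\in \mathrm{VP}(\mathcal{I})} \varphi_\pi(a),\quad \overline{H}_{\mathrm{cnt}}(\mathcal{I},\pi) = \inf_{a\in \mathrm{VP}_{\mathrm{cnt}}(\mathcal{I})} \varphi_\pi(a),\quad \overline{H}_{\mathrm{full}}(\mathcal{I},\pi) = \inf_{a\in \mathrm{VP}_{\mathrm{full}}(\mathcal{I},\pi)} \varphi_\pi(a),\quad \underline{H}(\mathcal{I},\pi) = \sup_{b\in K(\mathcal{I},\pi)} \varphi_\pi(b). \] Then for every $0<\lambda<1$, \[ \underline{H}(\mathcal{I},\pi) \leq \underline{H}_\lambda(\mathcal{I},\pi) \leq \overline{H}_\lambda(\mathcal{I},\pi) \leq \overline{H}_{\mathrm{full}}(\mathcal{I},\pi) \leq \overline{H}_{\mathrm{cnt}}(\mathcal{I},\pi) \leq \overline{H}_{\mathrm{fin}}(\mathcal{I},\pi). \]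
   Context: An $\ell$-dimensional $\mathcal{I}$-box is a product $J_1\times\cdots\times J_\ell\subseteq\Omega^\ell$ with all $J_i\in\mathcal{I}$. For $0<\lambda<1$, $N_\ell(\mathcal{I},\pi,\lambda)$ is the minimum number of $\ell$-dimensional $\mathcal{I}$-boxes whose union has $\pi^\ell$-measure at least $1-\lambda$ (taken to be $\infty$ if no finite number suffices). The lower and upper entropies are $\underline{H}_\lambda(\mathcal{I},\pi)=\liminf_{\ell\to\infty}\frac1\ell\log N_\ell(\mathcal{I},\pi,\lambda)$ and $\overline{H}_\lambda(\mathcal{I},\pi)=\limsup_{\ell\to\infty}\frac1\ell\log N_\ell(\mathcal{I},\pi,\lambda)$. For measurable $a:\Omega\to[0,\infty)$, $\varphi_\pi(a)=\int_\Omega -\log(a(x))\,\mathrm{d}\pi(x)$, with $-\log 0=\infty$. $\mathrm{VP}(\mathcal{I})$ is the set of finite convex combinations $\sum_k q_k\mathbf{1}_{J_k}$ ($J_k\in\mathcal{I}$, $q_k\ge0$, $\sum_k q_k=1$); $\mathrm{VP}_{\mathrm{cnt}}(\mathcal{I})$ is the set of countable such convex combinations. A probability measure $\beta$ defined on a $\sigma$-algebra $\mathcal{B}\subseteq\mathcal{P}(\mathcal{I})$ is compatible (with $\pi$) if the set $\{(J,x)\in\mathcal{I}\times\Omega : x\in J\}$ is measurable with respect to the completion of $\beta\times\pi$; then $a(x)=\int \mathbf{1}_J(x)\,\mathrm{d}\beta(J)$ is a measurable function, written $a=\mathbb{E}\mathbf{1}_J$. $\mathrm{VP}_{\mathrm{full}}(\mathcal{I},\pi)$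 is the set of all such $\mathbb{E}_{J\sim\beta}\mathbf{1}_J$ over compatible $\beta$. Finally, $K(\mathcal{I},\pi)$ is the set of measurable $b:\Omega\to(0,1]$ with $\int_J \frac1b\,\mathrm{d}\pi\le 1$ for all $J\in\mathcal{I}$. *)

theory Defs
  imports "HOL-Probability.Probability"
begin

text \<open>The logarithm extended by \<open>log 0 = -\<infinity>\<close> and \<open>log \<infinity> = \<infinity>\<close>; note that the library has \<open>ln 0 = 0\<close>.\<close>

definition eln :: "ereal \<Rightarrow> ereal" where
  "eln x = (if x \<le> 0 then -\<infinity> else if x = \<infinity> then \<infinity> else ereal (ln (real_of_ereal x)))"

definition boxes :: "'a set set \<Rightarrow> nat \<Rightarrow> (nat \<Rightarrow> 'a) set set" where
  "boxes \<I> l = {PiE {..<l} J | J. \<forall>i<l. J i \<in> \<I>}"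

text \<open>The infimum of the empty set in \<^typ>\<open>enat\<close> is \<open>\<infinity>\<close>; any other infimum in \<^typ>\<open>enat\<close> is attained.\<close>

definition cover_number :: "'a set set \<Rightarrow> 'a measure \<Rightarrow> real \<Rightarrow> nat \<Rightarrow> enat" where
  "cover_number \<I> M lam l =
     Inf {enat (card B) | B. finite B \<and> B \<subseteq> boxes \<I> l \<and>
            measure (PiM {..<l} (\<lambda>_. M)) (\<Union>B) \<ge> 1 - lam}"

definition lower_entropy :: "'a set set \<Rightarrow> 'a measure \<Rightarrow> real \<Rightarrow> ereal" where
  "lower_entropy \<I> M lam =
     liminf (\<lambda>l. ereal (1 / real l) * eln (ereal_of_enat (cover_number \<I> M lam l)))"

definition upper_entropy :: "'a set set \<Rightarrow> 'a measure \<Rightarrow> real \<Rightarrow> ereal" where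
  "upper_entropy \<I> M lam =
     limsup (\<lambda>l. ereal (1 / real l) * eln (ereal_of_enat (cover_number \<I> M lam l)))"

text \<open>The integral of \<open>- log a\<close> as an extended real: the integral of the positive part minus that of
  the negative part. The latter vanishes for \<open>a \<le> 1\<close>, hence for all functions in the sets below.
  As \<open>nn_integral_completion\<close> holds without a measurability assumption, this is also the integral
  with respect to the completion of \<open>M\<close> when \<open>a\<close> is measurable only with respect to the latter.\<close>

definition phi :: "'a measure \<Rightarrow> ('a \<Rightarrow> real) \<Rightarrow> ereal" where
  "phi M a = enn2ereal (\<integral>\<^sup>+x. e2ennreal (- eln (ereal (a x))) \<partial>M)
           - enn2ereal (\<integral>\<^sup>+x. e2ennreal (eln (ereal (a x))) \<partial>M)"

definition VP :: "'a set set \<Rightarrow> ('a \<Rightarrow> real) set" where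
  "VP \<I> = {\<lambda>x. \<Sum>k<n. q k * indicator (J k) x | (n::nat) q J.
            (\<forall>k<n. J k \<in> \<I> \<and> 0 \<le> q k) \<and> (\<Sum>k<n. q k) = 1}"

text \<open>Finite combinations are included: pad with weights \<open>0\<close>.\<close>

definition VP_cnt :: "'a set set \<Rightarrow> ('a \<Rightarrow> real) set" where
  "VP_cnt \<I> = {\<lambda>x. \<Sum>k. q k * indicator (J k) x | (q :: nat \<Rightarrow> real) J.
            (\<forall>k. J k \<in> \<I> \<and> 0 \<le> q k) \<and> q sums 1}"

definition compatible :: "'a set set \<Rightarrow> 'a measure \<Rightarrow> 'a set measure \<Rightarrow> bool" where
  "compatible \<I> M \<beta> \<longleftrightarrow> prob_space \<beta> \<and> space \<beta> = \<I> \<and>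
     {(J, x). J \<in> \<I> \<and> x \<in> space M \<and> x \<in> J} \<in> sets (completion (\<beta> \<Otimes>\<^sub>M M))"

text \<open>For compatible \<open>\<beta>\<close>, the set \<open>{J \<in> \<I>. x \<in> J}\<close> need only be measurable for the completion
  of \<open>\<beta>\<close>, and only for almost every \<open>x\<close>; on the exceptional null set the integral is \<open>0\<close> by
  the convention for non-integrable functions. The resulting function is measurable for the
  completion of \<open>M\<close>.\<close>

definition VP_full :: "'a set set \<Rightarrow> 'a measure \<Rightarrow> ('a \<Rightarrow> real) set" where
  "VP_full \<I> M = {\<lambda>x. \<integral>J. indicator J x \<partial>(completion \<beta>) | \<beta>. compatible \<I> M \<beta>}"

definition K :: "'a set set \<Rightarrow> 'a measure \<Rightarrow> ('a \<Rightarrow> real) set" where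
  "K \<I> M = {b \<in> borel_measurable M. (\<forall>x\<in>space M. 0 < b x \<and> b x \<le> 1) \<and>
              (\<forall>J\<in>\<I>. (\<integral>\<^sup>+x\<in>J. ennreal (1 / b x) \<partial>M) \<le> 1)}"

definition H_fin :: "'a set set \<Rightarrow> 'a measure \<Rightarrow> ereal" where
  "H_fin \<I> M = (INF a\<in>VP \<I>. phi M a)"

definition H_cnt :: "'a set set \<Rightarrow> 'a measure \<Rightarrow> ereal" where
  "H_cnt \<I> M = (INF a\<in>VP_cnt \<I>. phi M a)"

definition H_full :: "'a set set \<Rightarrow> 'a measure \<Rightarrow> ereal" where
  "H_full \<I> M = (INF a\<in>VP_full \<I> M. phi M a)"

definition H_lower :: "'a set set \<Rightarrow> 'a measure \<Rightarrow> ereal" where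
  "H_lower \<I> M = (SUP b\<in>K \<I> M. phi M b)"

end

theory Submission
  imports Defs
begin

text \<open>
  The lower bound is a volume count: for \<open>b \<in> K(\<I>, \<pi>)\<close> every box has integral at most \<open>1\<close> with respect to
  the density \<open>\<Prod>i. 1 / b(x\<^sub>i)\<close>, while by the law of large numbers this density is at least \<open>exp(l t)\<close>,
  for any \<open>t < \<phi>(b)\<close>, outside a set of small measure.

  For the upper bound let \<open>a = E 1\<^sub>J\<close> with \<open>J\<close> distributed according to \<open>\<beta>\<close> and \<open>t > \<phi>(a)\<close>. On a set \<open>G\<close> of
  measure close to \<open>1\<close> a random box drawn from \<open>\<beta>\<^sup>l\<close> contains a given point with probability
  \<open>\<Prod>i. a(x\<^sub>i) \<ge> exp(- l t)\<close>, so by Fubini some box covers at least this fraction of any given part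
  of \<open>G\<close>. Choosing boxes greedily, \<open>O(exp(l t))\<close> of them suffice. As inner bounds on the boxes are enough,
  the incidence set may be replaced by a measurable subset with null difference, which removes
  the completion.
\<close>

section \<open>A weak law of large numbers\<close>

lemma (in prob_space) prob_space_PiM_const: "prob_space (Pi\<^sub>M I (\<lambda>_. M))"
  by (intro prob_space_PiM prob_space_axioms)

text \<open>Independence amounts to the joint law being the product of the marginals. Restricting an
  extensional function to \<open>I\<close> changes nothing, so the joint law is that of the
  identity, and each coordinate has law \<open>M\<close>.\<close>

lemma (in prob_space) indep_vars_PiM_coordinates:
  assumes "I \<noteq> {}"
  shows "prob_space.indep_vars (Pi\<^sub>M I (\<lambda>_. M)) (\<lambda>_. M) (\<lambda>i x. x i) I"
proof -
  interpret P: prob_space "Pi\<^sub>M I (\<lambda>_. M)"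
    by (rule prob_space_PiM_const)
  have "distr (Pi\<^sub>M I (\<lambda>_. M)) (Pi\<^sub>M I (\<lambda>_. M)) (\<lambda>x. \<lambda>i\<in>I. x i) = distr (Pi\<^sub>M I (\<lambda>_. M)) (Pi\<^sub>M I (\<lambda>_. M)) (\<lambda>x. x)"
    by (intro distr_cong) (auto simp: space_PiM)
  also have "\<dots> = Pi\<^sub>M I (\<lambda>_. M)"
    by (rule distr_id)
  also have "\<dots> = Pi\<^sub>M I (\<lambda>i. distr (Pi\<^sub>M I (\<lambda>_. M)) M (\<lambda>x. x i))"
    by (intro PiM_cong refl distr_PiM_component[symmetric] prob_space_axioms)
  finally show ?thesis
    using assms by (subst P.indep_vars_iff_distr_eq_PiM') auto
qed

lemma (in prob_space) integrable_PiM_component: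
  fixes f :: "'a \<Rightarrow> real"
  assumes "integrable M f" "i \<in> I"
  shows "integrable (Pi\<^sub>M I (\<lambda>_. M)) (\<lambda>x. f (x i))"
    and "(\<integral>x. f (x i) \<partial>Pi\<^sub>M I (\<lambda>_. M)) = expectation f"
proof -
  have d: "distr (Pi\<^sub>M I (\<lambda>_. M)) M (\<lambda>x. x i) = M"
    using assms(2) by (intro distr_PiM_component prob_space_axioms)
  have m: "(\<lambda>x. x i) \<in> Pi\<^sub>M I (\<lambda>_. M) \<rightarrow>\<^sub>M M"
    using assms(2) by measurable
  show "integrable (Pi\<^sub>M I (\<lambda>_. M)) (\<lambda>x. f (x i))"
    using integrable_distr[OF m, of f] assms(1) by (simp add: d)
  show "(\<integral>x. f (x i) \<partial>Pi\<^sub>M I (\<lambda>_. M)) = expectation f"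
    using integral_distr[OF m, of f] assms(1) by (simp add: d)
qed

text \<open>Hoeffding's inequality for the independent coordinates bounds this probability by an
  exponential that decays in \<open>l\<close>.\<close>

lemma (in prob_space) upper_tail_bounded_tendsto_0:
  fixes X :: "'a \<Rightarrow> real"
  assumes [measurable]: "random_variable borel X"
    and bnd: "\<And>x. x \<in> space M \<Longrightarrow> \<bar>X x\<bar> \<le> c" and t: "expectation X < t"
  shows "(\<lambda>l. measure (Pi\<^sub>M {..<l} (\<lambda>_. M))
           {x \<in> space (Pi\<^sub>M {..<l} (\<lambda>_. M)). real l * t \<le> (\<Sum>i<l. X (x i))}) \<longlonglongrightarrow> 0"
proof -
  \<comment> \<open>Adding 1 makes the interval from \<open>- d\<close> to \<open>d\<close>
    nondegenerate even for \<open>c = 0\<close>, so Hoeffding's denominator is positive.\<close>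
  define d where "d = \<bar>c\<bar> + 1"
  have Xd: "\<bar>X x\<bar> \<le> d" if "x \<in> space M" for x
    using bnd[OF that] by (auto simp: d_def)
  have d0: "d > 0" by (simp add: d_def add_nonneg_pos)
  define e where "e = t - expectation X"
  have e: "e > 0" using t by (simp add: e_def)
  have intX: "integrable M X"
    by (rule integrable_const_bound[where B = d]) (use Xd in auto)
  have main: "measure (Pi\<^sub>M {..<l} (\<lambda>_. M))
           {x \<in> space (Pi\<^sub>M {..<l} (\<lambda>_. M)). real l * t \<le> (\<Sum>i<l. X (x i))}
     \<le> exp (- (2 * e\<^sup>2 / (2 * d)\<^sup>2 * real l))" if l: "l > 0" for l
  proof -
    interpret P: prob_space "Pi\<^sub>M {..<l} (\<lambda>_. M)"
      by (rule prob_space_PiM_const)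
    have ind: "P.indep_vars (\<lambda>_. borel) (\<lambda>i x. X (x i)) {..<l}"
      by (rule P.indep_vars_compose2[OF indep_vars_PiM_coordinates]) (use l in auto)
    have "P.expectation (\<lambda>x. X (x i)) = expectation X" if "i < l" for i
      using integrable_PiM_component(2)[OF intX, of i "{..<l}"] that by simp
    hence mu: "(\<Sum>i<l. P.expectation (\<lambda>x. X (x i))) = real l * expectation X"
      by simp
    interpret H: Hoeffding_ineq "Pi\<^sub>M {..<l} (\<lambda>_. M)" "{..<l}" "\<lambda>i x. X (x i)" "\<lambda>_. - d" "\<lambda>_. d"
       "real l * expectation X"
    proof unfold_locales
      fix i assume i: "i \<in> {..<l}"
      have "x i \<in> space M" if "x \<in> space (Pi\<^sub>M {..<l} (\<lambda>_. M))" for x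
        using that i by (auto simp: space_PiM)
      from Xd[OF this] show "AE x in Pi\<^sub>M {..<l} (\<lambda>_. M). X (x i) \<in> {- d..d}"
        by (intro AE_I2) (auto simp: abs_le_iff minus_le_iff)
    qed (use ind mu in \<open>simp_all\<close>)
    have "P.prob {x \<in> space (Pi\<^sub>M {..<l} (\<lambda>_. M)). real l * expectation X + real l * e \<le> (\<Sum>i<l. X (x i))}
       \<le> exp (- 2 * (real l * e)\<^sup>2 / (\<Sum>i<l. (d - - d)\<^sup>2))"
      by (rule H.Hoeffding_ineq_ge) (use l e d0 in auto)
    also have "real l * expectation X + real l * e = real l * t"
      by (simp add: e_def algebra_simps)
    also have "- 2 * (real l * e)\<^sup>2 / (\<Sum>i<l. (d - - d)\<^sup>2) = - (2 * e\<^sup>2 / (2 * d)\<^sup>2 * real l)"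
      using l d0 by (simp add: field_simps power2_eq_square)
    finally show ?thesis .
  qed
  have exp0: "(\<lambda>l. exp (- (k * real l))) \<longlonglongrightarrow> 0" if "k > 0" for k :: real
    using that by real_asymp
  have "2 * e\<^sup>2 / (2 * d)\<^sup>2 > 0" using e d0 by simp
  hence lim: "(\<lambda>l. exp (- (2 * e\<^sup>2 / (2 * d)\<^sup>2 * real l))) \<longlonglongrightarrow> 0"
    using exp0 by blast
  show ?thesis
  proof (rule tendsto_sandwich[OF _ _ tendsto_const lim])
    show "\<forall>\<^sub>F l in sequentially. measure (Pi\<^sub>M {..<l} (\<lambda>_. M))
        {x \<in> space (Pi\<^sub>M {..<l} (\<lambda>_. M)). real l * t \<le> (\<Sum>i<l. X (x i))}
      \<le> exp (- (2 * e\<^sup>2 / (2 * d)\<^sup>2 * real l))"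
      using eventually_gt_at_top[of 0] by eventually_elim (rule main)
  qed simp
qed

text \<open>Only the first moment of \<open>- ln a\<close> is finite, hence the truncation argument.\<close>

lemma (in prob_space) upper_tail_tendsto_0:
  fixes X :: "'a \<Rightarrow> real"
  assumes X: "integrable M X" and t: "expectation X < t"
  shows "(\<lambda>l. measure (Pi\<^sub>M {..<l} (\<lambda>_. M))
           {x \<in> space (Pi\<^sub>M {..<l} (\<lambda>_. M)). real l * t \<le> (\<Sum>i<l. X (x i))}) \<longlonglongrightarrow> 0"
proof (rule LIMSEQ_I)
  fix \<delta> :: real assume \<delta>: "\<delta> > 0"
  have [measurable]: "random_variable borel X" using X by simp
  \<comment> \<open>With half the gap, \<open>t - e\<close> is the midpoint between the mean and
    \<open>t\<close>; this leaves room for the truncation error.\<close>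
  define e where "e = (t - expectation X) / 2"
  have e: "e > 0" using t by (simp add: e_def)
  define Y where "Y m x = max (- real m) (min (real m) (X x))" for m x
  have [measurable]: "random_variable borel (Y m)" for m unfolding Y_def by measurable
  have "(\<lambda>m. expectation (\<lambda>x. \<bar>X x - Y m x\<bar>)) \<longlonglongrightarrow> expectation (\<lambda>x. 0)"
  proof (rule integral_dominated_convergence)
    show "integrable M (\<lambda>x. \<bar>X x\<bar>)" using X by simp
    show "AE x in M. (\<lambda>m. \<bar>X x - Y m x\<bar>) \<longlonglongrightarrow> 0"
    proof (intro AE_I2 tendsto_eventually)
      fix x
      obtain m0 where "\<bar>X x\<bar> \<le> real m0" using real_arch_simple by blast
      thus "\<forall>\<^sub>F m in sequentially. \<bar>X x - Y m x\<bar> = 0"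
        by (intro eventually_mono[OF eventually_ge_at_top[of m0]]) (auto simp: Y_def)
    qed
    show "AE x in M. norm \<bar>X x - Y m x\<bar> \<le> \<bar>X x\<bar>" for m
      by (intro AE_I2) (auto simp: Y_def)
  qed auto
  \<comment> \<open>The bound \<open>e / 2\<close> keeps the mean of \<open>Y m\<close> below
    \<open>t - e\<close>; the bound \<open>e * \<delta> / 2\<close> lets Markov's inequality give
    probability below \<open>\<delta> / 2\<close>.\<close>
  moreover have "min (e / 2) (e * \<delta> / 2) > 0" using e \<delta> by simp
  ultimately have "\<forall>\<^sub>F m in sequentially. expectation (\<lambda>x. \<bar>X x - Y m x\<bar>) < min (e / 2) (e * \<delta> / 2)"
    by (intro order_tendstoD) auto
  then obtain m where m: "expectation (\<lambda>x. \<bar>X x - Y m x\<bar>) < min (e / 2) (e * \<delta> / 2)"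
    by (auto simp: eventually_sequentially)
  have intY: "integrable M (Y m)"
    by (rule integrable_const_bound[where B = "real m"]) (auto simp: Y_def)
  hence intD: "integrable M (\<lambda>x. \<bar>X x - Y m x\<bar>)" using X by auto
  have "expectation (Y m) - expectation X \<le> expectation (\<lambda>x. \<bar>X x - Y m x\<bar>)"
    by (subst Bochner_Integration.integral_diff[symmetric]) (auto intro!: integral_mono intY X intD)
  hence EY: "expectation (Y m) < t - e" using m e by (simp add: e_def field_simps)
  have "(\<lambda>l. measure (Pi\<^sub>M {..<l} (\<lambda>_. M))
           {x \<in> space (Pi\<^sub>M {..<l} (\<lambda>_. M)). real l * (t - e) \<le> (\<Sum>i<l. Y m (x i))}) \<longlonglongrightarrow> 0"
    by (rule upper_tail_bounded_tendsto_0[where c = "real m", OF _ _ EY]) (auto simp: Y_def)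
  from order_tendstoD(2)[OF this, of "\<delta> / 2"] \<delta> obtain l0 where l0:
    "\<And>l. l \<ge> l0 \<Longrightarrow> measure (Pi\<^sub>M {..<l} (\<lambda>_. M))
      {x \<in> space (Pi\<^sub>M {..<l} (\<lambda>_. M)). real l * (t - e) \<le> (\<Sum>i<l. Y m (x i))} < \<delta> / 2"
    by (auto simp: eventually_sequentially)
  show "\<exists>n0. \<forall>l\<ge>n0. norm (measure (Pi\<^sub>M {..<l} (\<lambda>_. M))
       {x \<in> space (Pi\<^sub>M {..<l} (\<lambda>_. M)). real l * t \<le> (\<Sum>i<l. X (x i))} - 0) < \<delta>"
  proof (intro exI allI impI)
    \<comment> \<open>Starting at \<open>Suc l0\<close> also gives \<open>l > 0\<close>, so that the
      Markov threshold \<open>real l * e\<close> is positive.\<close>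
    fix l assume l: "l \<ge> Suc l0"
    define P where "P = Pi\<^sub>M {..<l} (\<lambda>_. M)"
    interpret P: prob_space P
      unfolding P_def by (rule prob_space_PiM_const)
    define D where "D x = (\<Sum>i<l. \<bar>X (x i) - Y m (x i)\<bar>)" for x
    have mX: "(\<lambda>x. X (x i)) \<in> borel_measurable P" "(\<lambda>x. Y m (x i)) \<in> borel_measurable P" if "i < l" for i
      using that unfolding P_def by (auto intro!: measurable_compose[OF measurable_component_singleton])
    have [measurable]: "(\<lambda>x. \<Sum>i<l. X (x i)) \<in> borel_measurable P" "(\<lambda>x. \<Sum>i<l. Y m (x i)) \<in> borel_measurable P"
      "D \<in> borel_measurable P"
      unfolding D_def using mX by (auto intro!: borel_measurable_sum borel_measurable_abs borel_measurable_diff)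
    have intD': "integrable P D"
      unfolding D_def P_def
      by (intro Bochner_Integration.integrable_sum integrable_PiM_component(1)[where f = "\<lambda>x. \<bar>X x - Y m x\<bar>"] intD) auto
    have ED: "P.expectation D = real l * expectation (\<lambda>x. \<bar>X x - Y m x\<bar>)"
      unfolding D_def P_def
      by (subst Bochner_Integration.integral_sum)
         (auto intro!: integrable_PiM_component(1)[where f = "\<lambda>x. \<bar>X x - Y m x\<bar>"]
           simp: intD integrable_PiM_component(2)[where f = "\<lambda>x. \<bar>X x - Y m x\<bar>"])
    have D0: "D x \<ge> 0" for x
      unfolding D_def by (intro sum_nonneg) auto
    have le: "real l * e > 0" using l e by simp
    have "P.prob {x \<in> space P. real l * e \<le> D x} \<le> P.expectation D / (real l * e)"
      by (rule integral_Markov_inequality_measure[where A = "{}"]) (use intD' le D0 in auto)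
    also have "\<dots> = expectation (\<lambda>x. \<bar>X x - Y m x\<bar>) / e" using l by (simp add: ED)
    also have "\<dots> < \<delta> / 2" using m e by (simp add: field_simps)
    finally have 1: "P.prob {x \<in> space P. real l * e \<le> D x} < \<delta> / 2" .
    \<comment> \<open>If the sum of the \<open>X (x i)\<close> reaches \<open>l * t\<close>, then
      either the truncated sum reaches \<open>l * (t - e)\<close> or the total truncation error
      \<open>D\<close> reaches \<open>l * e\<close>.\<close>
    have "P.prob {x \<in> space P. real l * t \<le> (\<Sum>i<l. X (x i))} \<le>
       P.prob ({x \<in> space P. real l * (t - e) \<le> (\<Sum>i<l. Y m (x i))} \<union> {x \<in> space P. real l * e \<le> D x})"
    proof (rule P.finite_measure_mono)
      have "(\<Sum>i<l. X (x i)) \<le> (\<Sum>i<l. Y m (x i)) + D x" for x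
        unfolding D_def sum.distrib[symmetric] by (intro sum_mono) auto
      thus "{x \<in> space P. real l * t \<le> (\<Sum>i<l. X (x i))} \<subseteq>
        {x \<in> space P. real l * (t - e) \<le> (\<Sum>i<l. Y m (x i))} \<union> {x \<in> space P. real l * e \<le> D x}"
        by (auto simp: algebra_simps not_le) (smt (verit))
    qed measurable
    also have "\<dots> \<le> P.prob {x \<in> space P. real l * (t - e) \<le> (\<Sum>i<l. Y m (x i))} + P.prob {x \<in> space P. real l * e \<le> D x}"
      by (rule measure_Un_le) measurable
    also have "\<dots> < \<delta>" using 1 l0[of l] l by (simp add: P_def)
    finally show "norm (measure (Pi\<^sub>M {..<l} (\<lambda>_. M))
       {x \<in> space (Pi\<^sub>M {..<l} (\<lambda>_. M)). real l * t \<le> (\<Sum>i<l. X (x i))} - 0) < \<delta>"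
      by (simp add: P_def)
  qed
qed

section \<open>The lower bound\<close>

lemma eln_ereal: "0 < x \<Longrightarrow> eln (ereal x) = ereal (ln x)"
  by (simp add: eln_def)

section \<open>Boxes, cover numbers and their exponential rates\<close>

lemma boxes_measurable:
  assumes "\<I> \<subseteq> sets M" "C \<in> boxes \<I> l"
  shows "C \<in> sets (Pi\<^sub>M {..<l} (\<lambda>_. M))"
  using assms by (auto simp: boxes_def intro!: sets_PiM_I_finite)

lemma cover_number_attained:
  assumes "cover_number \<I> M lam l = enat N"
  obtains B where "finite B" "B \<subseteq> boxes \<I> l" "1 - lam \<le> measure (Pi\<^sub>M {..<l} (\<lambda>_. M)) (\<Union>B)" "card B = N"
proof -
  define A where "A = {enat (card B) | B. finite B \<and> B \<subseteq> boxes \<I> l \<and>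
            measure (Pi\<^sub>M {..<l} (\<lambda>_. M)) (\<Union>B) \<ge> 1 - lam}"
  have Inf: "Inf A = enat N" using assms by (simp add: cover_number_def A_def)
  hence "A \<noteq> {}" by (auto simp: top_enat_def)
  hence "Inf A \<in> A" by (auto simp: Inf_enat_def intro: LeastI)
  with Inf show ?thesis using that by (auto simp: A_def)
qed

text \<open>A constant factor in the size of a cover changes the rate only by
  \<open>ln c / real l\<close>, which vanishes in the limit. If there is no finite cover, the right
  side is infinite.\<close>

lemma entropy_rate_ge:
  assumes "0 < l" "0 < c"
    and "\<And>B. \<lbrakk>finite B; B \<subseteq> boxes \<I> l; 1 - lam \<le> measure (Pi\<^sub>M {..<l} (\<lambda>_. M)) (\<Union>B)\<rbrakk>
          \<Longrightarrow> c * exp (real l * t) \<le> real (card B)"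
  shows "ereal (t + ln c / real l) \<le> ereal (1 / real l) * eln (ereal_of_enat (cover_number \<I> M lam l))"
proof (cases "cover_number \<I> M lam l")
  case infinity
  thus ?thesis using \<open>0 < l\<close> by (simp add: eln_def)
next
  case (enat N)
  then obtain B where "finite B" "B \<subseteq> boxes \<I> l" "1 - lam \<le> measure (Pi\<^sub>M {..<l} (\<lambda>_. M)) (\<Union>B)" "card B = N"
    by (rule cover_number_attained)
  with assms(3) have N: "c * exp (real l * t) \<le> real N" by blast
  have pos: "0 < c * exp (real l * t)" using \<open>0 < c\<close> by simp
  have "ln c + real l * t = ln (c * exp (real l * t))" using \<open>0 < c\<close> by (simp add: ln_mult)
  also have "\<dots> \<le> ln (real N)" using N pos by (subst ln_le_cancel_iff) auto
  finally have "(ln c + real l * t) / real l \<le> ln (real N) / real l" by (intro divide_right_mono) auto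
  hence "t + ln c / real l \<le> 1 / real l * ln (real N)" using \<open>0 < l\<close> by (simp add: add_divide_distrib)
  moreover have "0 < real N" using N pos by linarith
  ultimately show ?thesis by (simp add: enat eln_ereal)
qed

text \<open>A single cover already bounds the minimum; again the constant factor contributes only
  \<open>ln c / real l\<close>.\<close>

lemma entropy_rate_le:
  assumes "0 < l" "0 < c"
    and B: "finite B" "B \<subseteq> boxes \<I> l" "1 - lam \<le> measure (Pi\<^sub>M {..<l} (\<lambda>_. M)) (\<Union>B)"
    and card: "real (card B) \<le> c * exp (real l * t)"
  shows "ereal (1 / real l) * eln (ereal_of_enat (cover_number \<I> M lam l)) \<le> ereal (t + ln c / real l)"
proof -
  have "cover_number \<I> M lam l \<le> enat (card B)"
    unfolding cover_number_def using B by (intro Inf_lower) blast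
  then obtain N where N: "cover_number \<I> M lam l = enat N" "N \<le> card B"
    by (cases "cover_number \<I> M lam l") auto
  show ?thesis
  proof (cases "N = 0")
    \<comment> \<open>Here \<open>eln 0\<close> is minus infinity and so is the rate, whereas
      \<open>ln 0 = 0\<close> would not express this.\<close>
    case True
    thus ?thesis using \<open>0 < l\<close> by (simp add: N zero_enat_def[symmetric] eln_def)
  next
    case False
    have "ln (real N) \<le> ln (c * exp (real l * t))"
      using False N(2) card \<open>0 < c\<close> by (subst ln_le_cancel_iff) auto
    also have "\<dots> = ln c + real l * t" using \<open>0 < c\<close> by (simp add: ln_mult)
    finally have "ln (real N) / real l \<le> (ln c + real l * t) / real l" by (intro divide_right_mono) auto
    hence "1 / real l * ln (real N) \<le> t + ln c / real l" using \<open>0 < l\<close> by (simp add: add_divide_distrib)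
    thus ?thesis using False by (simp add: N eln_ereal)
  qed
qed

lemma tendsto_add_const_over: "(\<lambda>l. ereal (t + c / real l)) \<longlonglongrightarrow> ereal t"
proof -
  have "(\<lambda>l. t + c / real l) \<longlonglongrightarrow> t" by real_asymp
  thus ?thesis by simp
qed

text \<open>The density and the indicator of a box are both products over the coordinates, so by
  Tonelli the integral is a product of one-dimensional integrals, each at most 1 by the definition
  of \<open>K\<close>.\<close>

lemma (in prob_space) nn_integral_box_le_1:
  assumes "\<I> \<subseteq> sets M" "b \<in> K \<I> M" "C \<in> boxes \<I> l"
  shows "(\<integral>\<^sup>+x. (\<Prod>i<l. ennreal (1 / b (x i))) * indicator C x \<partial>Pi\<^sub>M {..<l} (\<lambda>_. M)) \<le> 1"
proof -
  interpret product_sigma_finite "\<lambda>_. M" ..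
  obtain J where J: "\<And>i. i < l \<Longrightarrow> J i \<in> \<I>" and C: "C = Pi\<^sub>E {..<l} J"
    using assms(3) by (auto simp: boxes_def)
  have [measurable]: "b \<in> borel_measurable M" using assms(2) by (simp add: K_def)
  have "(\<integral>\<^sup>+x. (\<Prod>i<l. ennreal (1 / b (x i))) * indicator C x \<partial>Pi\<^sub>M {..<l} (\<lambda>_. M)) =
     (\<integral>\<^sup>+x. (\<Prod>i<l. ennreal (1 / b (x i)) * indicator (J i) (x i)) \<partial>Pi\<^sub>M {..<l} (\<lambda>_. M))"
  proof (rule nn_integral_cong)
    fix x assume x: "x \<in> space (Pi\<^sub>M {..<l} (\<lambda>_. M))"
    have "indicator C x = (\<Prod>i<l. indicator (J i) (x i) :: ennreal)"
    proof (cases "x \<in> C")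
      case True
      thus ?thesis by (auto simp: C PiE_iff intro!: prod.neutral[symmetric])
    next
      case False
      then obtain i where "i < l" "x i \<notin> J i" using x by (auto simp: C PiE_iff space_PiM)
      hence "(\<Prod>i<l. indicator (J i) (x i) :: ennreal) = 0" by (intro prod_zero) (auto intro!: bexI[of _ i])
      thus ?thesis using False by simp
    qed
    thus "(\<Prod>i<l. ennreal (1 / b (x i))) * indicator C x = (\<Prod>i<l. ennreal (1 / b (x i)) * indicator (J i) (x i))"
      by (simp add: prod.distrib)
  qed
  also have "\<dots> = (\<Prod>i<l. \<integral>\<^sup>+x. ennreal (1 / b x) * indicator (J i) x \<partial>M)"
  proof (rule product_nn_integral_prod)
    fix i assume "i \<in> {..<l}"
    hence [measurable]: "J i \<in> sets M" using J assms(1) by auto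
    show "(\<lambda>x. ennreal (1 / b x) * indicator (J i) x) \<in> borel_measurable M" by measurable
  qed simp
  also have "\<dots> \<le> 1"
    using J assms(2) by (intro prod_le_1) (auto simp: K_def)
  finally show ?thesis .
qed

text \<open>On the set where the sum of logarithms is below \<open>- s\<close>, the product density
  is at least \<open>exp s\<close>. Its integral over the covered part of this set is at most the
  sum of its integrals over the boxes, each contributing at most 1.\<close>

lemma (in prob_space) card_cover_ge:
  assumes I: "\<I> \<subseteq> sets M" and b: "b \<in> K \<I> M" and B: "finite B" "B \<subseteq> boxes \<I> l"
  defines "P \<equiv> Pi\<^sub>M {..<l} (\<lambda>_. M)"
  shows "measure P (\<Union>B \<inter> {x \<in> space P. (\<Sum>i<l. ln (b (x i))) < - s}) * exp s \<le> real (card B)"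
proof -
  interpret P: prob_space P unfolding P_def by (rule prob_space_PiM_const)
  have [measurable]: "b \<in> borel_measurable M" and b0: "\<And>x. x \<in> space M \<Longrightarrow> 0 < b x"
    using b by (auto simp: K_def)
  have sB: "C \<in> sets P" if "C \<in> B" for C
    using that B boxes_measurable[OF I, of C l] by (auto simp: P_def)
  have mb: "(\<lambda>x. b (x i)) \<in> borel_measurable P" if "i < l" for i
    using that unfolding P_def by (auto intro!: measurable_compose[OF measurable_component_singleton])
  have [measurable]: "(\<lambda>x. \<Sum>i<l. ln (b (x i))) \<in> borel_measurable P"
    using mb by (auto intro!: borel_measurable_sum borel_measurable_ln)
  have [measurable]: "(\<lambda>x. \<Prod>i<l. ennreal (1 / b (x i))) \<in> borel_measurable P"
    using mb by (auto intro!: borel_measurable_prod_ennreal)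
  have [measurable]: "\<Union>B \<in> sets P" using sB B(1) by auto
  define G where "G = {x \<in> space P. (\<Sum>i<l. ln (b (x i))) < - s}"
  have [measurable]: "G \<in> sets P" unfolding G_def by measurable
  have "ennreal (measure P (\<Union>B \<inter> G) * exp s) = (\<integral>\<^sup>+x. ennreal (exp s) * indicator (\<Union>B \<inter> G) x \<partial>P)"
    by (simp add: nn_integral_cmult_indicator P.emeasure_eq_measure ennreal_mult' mult.commute)
  also have "\<dots> \<le> (\<integral>\<^sup>+x. (\<Sum>C\<in>B. (\<Prod>i<l. ennreal (1 / b (x i))) * indicator C x) \<partial>P)"
  proof (rule nn_integral_mono)
    fix x assume x: "x \<in> space P"
    show "ennreal (exp s) * indicator (\<Union>B \<inter> G) x \<le> (\<Sum>C\<in>B. (\<Prod>i<l. ennreal (1 / b (x i))) * indicator C x)"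
    proof (cases "x \<in> \<Union>B \<inter> G")
      case True
      then obtain C where C: "C \<in> B" "x \<in> C" by auto
      have pos: "0 < b (x i)" if "i < l" for i
        using b0 that x by (auto simp: P_def space_PiM)
      have "exp s \<le> exp (\<Sum>i<l. - ln (b (x i)))" using True by (simp add: G_def sum_negf)
      also have "\<dots> = (\<Prod>i<l. 1 / b (x i))"
        unfolding exp_sum[OF finite_lessThan] using pos by (intro prod.cong) (auto simp: exp_minus field_simps)
      finally have "ennreal (exp s) \<le> ennreal (\<Prod>i<l. 1 / b (x i))" by (rule ennreal_leI)
      also have "\<dots> = (\<Prod>i<l. ennreal (1 / b (x i)))"
        using pos by (intro prod_ennreal[symmetric]) (auto simp: less_imp_le)
      also have "\<dots> = (\<Prod>i<l. ennreal (1 / b (x i))) * indicator C x" using C by simp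
      also have "\<dots> \<le> (\<Sum>C\<in>B. (\<Prod>i<l. ennreal (1 / b (x i))) * indicator C x)"
        using B(1) C(1) by (intro member_le_sum) auto
      finally show ?thesis using True by simp
    qed simp
  qed
  also have "\<dots> = (\<Sum>C\<in>B. \<integral>\<^sup>+x. (\<Prod>i<l. ennreal (1 / b (x i))) * indicator C x \<partial>P)"
  proof (rule nn_integral_sum)
    fix C assume "C \<in> B"
    from sB[OF this] have [measurable]: "C \<in> sets P" .
    show "(\<lambda>x. (\<Prod>i<l. ennreal (1 / b (x i))) * indicator C x) \<in> borel_measurable P" by measurable
  qed
  also have "\<dots> \<le> (\<Sum>C\<in>B. 1)"
    unfolding P_def by (intro sum_mono nn_integral_box_le_1[OF I b]) (use B in auto)
  also have "\<dots> = ennreal (real (card B))" by (simp add: ennreal_of_nat_eq_real_of_nat)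
  finally show ?thesis by (simp add: G_def)
qed

text \<open>For large \<open>l\<close> the points whose density is at most
  \<open>exp (real l * t)\<close> have measure below \<open>(1 - lam) / 2\<close>. A cover of
  measure \<open>1 - lam\<close> therefore retains at least \<open>(1 - lam) / 2\<close> where the
  density is larger, and the volume count applies with \<open>s = real l * t\<close>.\<close>

lemma (in prob_space) lower_entropy_ge:
  assumes I: "\<I> \<subseteq> sets M" and b: "b \<in> K \<I> M" and lam: "lam < 1"
    and int: "integrable M (\<lambda>x. ln (b x))" and t: "t < expectation (\<lambda>x. - ln (b x))"
  shows "ereal t \<le> lower_entropy \<I> M lam"
proof -
  have "(\<lambda>l. measure (Pi\<^sub>M {..<l} (\<lambda>_. M))
      {x \<in> space (Pi\<^sub>M {..<l} (\<lambda>_. M)). real l * (- t) \<le> (\<Sum>i<l. ln (b (x i)))}) \<longlonglongrightarrow> 0"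
    using t by (intro upper_tail_tendsto_0 int) simp
  hence "\<forall>\<^sub>F l in sequentially. measure (Pi\<^sub>M {..<l} (\<lambda>_. M))
      {x \<in> space (Pi\<^sub>M {..<l} (\<lambda>_. M)). real l * (- t) \<le> (\<Sum>i<l. ln (b (x i)))} < (1 - lam) / 2"
    using lam by (intro order_tendstoD(2)) auto
  hence "\<forall>\<^sub>F l in sequentially. ereal (t + ln ((1 - lam) / 2) / real l)
     \<le> ereal (1 / real l) * eln (ereal_of_enat (cover_number \<I> M lam l))"
    using eventually_gt_at_top[of 0]
  proof eventually_elim
    case (elim l)
    define P where "P = Pi\<^sub>M {..<l} (\<lambda>_. M)"
    interpret P: prob_space P unfolding P_def by (rule prob_space_PiM_const)
    have [measurable]: "b \<in> borel_measurable M" using b by (simp add: K_def)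
    have "(\<lambda>x. b (x i)) \<in> borel_measurable P" if "i < l" for i
      using that unfolding P_def by (auto intro!: measurable_compose[OF measurable_component_singleton])
    hence [measurable]: "(\<lambda>x. \<Sum>i<l. ln (b (x i))) \<in> borel_measurable P"
      by (auto intro!: borel_measurable_sum borel_measurable_ln)
    show ?case
    proof (rule entropy_rate_ge)
      fix B assume B: "finite B" "B \<subseteq> boxes \<I> l" and cov: "1 - lam \<le> measure (Pi\<^sub>M {..<l} (\<lambda>_. M)) (\<Union>B)"
      have [measurable]: "\<Union>B \<in> sets P"
        unfolding P_def using B boxes_measurable[OF I, of _ l] by (intro sets.finite_Union) auto
      have "1 - lam \<le> P.prob (\<Union>B)" using cov by (simp add: P_def)
      also have "\<dots> \<le> P.prob ((\<Union>B \<inter> {x \<in> space P. (\<Sum>i<l. ln (b (x i))) < - (real l * t)}) \<union>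
          {x \<in> space P. real l * (- t) \<le> (\<Sum>i<l. ln (b (x i)))})"
        using sets.sets_into_space[OF \<open>\<Union>B \<in> sets P\<close>] by (intro P.finite_measure_mono) auto
      also have "\<dots> \<le> P.prob (\<Union>B \<inter> {x \<in> space P. (\<Sum>i<l. ln (b (x i))) < - (real l * t)}) +
          P.prob {x \<in> space P. real l * (- t) \<le> (\<Sum>i<l. ln (b (x i)))}"
        by (rule measure_Un_le) measurable
      also have "\<dots> \<le> P.prob (\<Union>B \<inter> {x \<in> space P. (\<Sum>i<l. ln (b (x i))) < - (real l * t)}) + (1 - lam) / 2"
        using elim(1) by (simp add: P_def)
      finally have "(1 - lam) / 2 \<le> P.prob (\<Union>B \<inter> {x \<in> space P. (\<Sum>i<l. ln (b (x i))) < - (real l * t)})"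
        by (simp add: field_simps)
      hence "(1 - lam) / 2 * exp (real l * t) \<le>
         P.prob (\<Union>B \<inter> {x \<in> space P. (\<Sum>i<l. ln (b (x i))) < - (real l * t)}) * exp (real l * t)"
        by (intro mult_right_mono) auto
      also have "\<dots> \<le> real (card B)"
        unfolding P_def by (rule card_cover_ge[OF I b B])
      finally show "(1 - lam) / 2 * exp (real l * t) \<le> real (card B)" .
    qed (use lam elim in auto)
  qed
  hence "liminf (\<lambda>l. ereal (t + ln ((1 - lam) / 2) / real l)) \<le> lower_entropy \<I> M lam"
    unfolding lower_entropy_def by (rule Liminf_mono)
  thus ?thesis
    using lim_imp_Liminf[OF sequentially_bot tendsto_add_const_over] by simp
qed

section \<open>Truncation of weights and the lower entropy bound\<close>

lemma phi_eq_nn_integral: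
  assumes "AE x in M. a x \<le> 1"
  shows "phi M a = enn2ereal (\<integral>\<^sup>+x. e2ennreal (- eln (ereal (a x))) \<partial>M)"
proof -
  have "(\<integral>\<^sup>+x. e2ennreal (eln (ereal (a x))) \<partial>M) = (\<integral>\<^sup>+x. 0 \<partial>M)"
  proof (rule nn_integral_cong_AE)
    show "AE x in M. e2ennreal (eln (ereal (a x))) = 0"
      using assms
    proof eventually_elim
      case (elim x)
      hence "eln (ereal (a x)) \<le> 0" by (auto simp: eln_def)
      thus ?case by (rule e2ennreal_neg)
    qed
  qed
  thus ?thesis by (simp add: phi_def zero_ennreal.rep_eq)
qed

text \<open>Enlarging \<open>b\<close> decreases \<open>1 / b\<close>, so the integral constraints
  survive. The positive lower bound \<open>c\<close> makes the logarithm bounded, hence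
  integrable.\<close>

lemma K_max:
  assumes "b \<in> K \<I> M" "0 < c" "c \<le> 1"
  shows "(\<lambda>x. max (b x) c) \<in> K \<I> M"
  unfolding K_def
proof (intro CollectI conjI ballI)
  show "(\<lambda>x. max (b x) c) \<in> borel_measurable M" using assms(1) by (auto simp: K_def)
  fix J assume J: "J \<in> \<I>"
  have "(\<integral>\<^sup>+x\<in>J. ennreal (1 / max (b x) c) \<partial>M) \<le> (\<integral>\<^sup>+x\<in>J. ennreal (1 / b x) \<partial>M)"
    using assms by (intro nn_integral_mono mult_right_mono ennreal_leI divide_left_mono) (auto simp: K_def)
  also have "\<dots> \<le> 1" using assms J by (auto simp: K_def)
  finally show "(\<integral>\<^sup>+x\<in>J. ennreal (1 / max (b x) c) \<partial>M) \<le> 1" .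
qed (use assms in \<open>auto simp: K_def\<close>)

text \<open>Since \<open>phi M b\<close> may be infinite, \<open>b\<close> is bounded below by
  \<open>exp (- real m)\<close>. The truncations stay in \<open>K\<close>, have integrable
  logarithms, and by monotone convergence their values of \<open>phi\<close> increase to
  \<open>phi M b\<close>, so one of them exceeds any \<open>s\<close> below it.\<close>

lemma (in prob_space) H_lower_le_lower_entropy:
  assumes I: "\<I> \<subseteq> sets M" and lam: "lam < 1"
  shows "H_lower \<I> M \<le> lower_entropy \<I> M lam"
  unfolding H_lower_def
proof (rule SUP_least, rule dense_le)
  fix b s assume b: "b \<in> K \<I> M" and s: "s < phi M b"
  have [measurable]: "b \<in> borel_measurable M" and b0: "\<And>x. x \<in> space M \<Longrightarrow> 0 < b x \<and> b x \<le> 1"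
    using b by (auto simp: K_def)
  define c where "c m x = max (b x) (exp (- real m))" for m x
  have [measurable]: "c m \<in> borel_measurable M" for m unfolding c_def by measurable
  have cK: "c m \<in> K \<I> M" for m unfolding c_def by (intro K_max b) auto
  have c: "exp (- real m) \<le> c m x" "0 < c m x" "x \<in> space M \<Longrightarrow> c m x \<le> 1" for m x
    using b0[of x] by (auto simp: c_def less_max_iff_disj)
  have lc: "ln (c m x) \<le> 0" "- real m \<le> ln (c m x)" if "x \<in> space M" for m x
    using c(3)[OF that, of m] c(2)[of m x] c(1)[of m x] by (simp_all add: ln_ge_iff)
  have intc: "integrable M (\<lambda>x. ln (c m x))" for m
  proof (rule integrable_const_bound)
    have "norm (ln (c m x)) \<le> real m" if "x \<in> space M" for x
      using lc[OF that, of m] by (simp add: abs_le_iff)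
    thus "AE x in M. norm (ln (c m x)) \<le> real m" by (rule AE_I2)
  qed measurable
  have "(\<integral>\<^sup>+x. e2ennreal (- eln (ereal (b x))) \<partial>M) = (\<integral>\<^sup>+x. (SUP m. ennreal (- ln (c m x))) \<partial>M)"
  proof (rule nn_integral_cong)
    fix x assume x: "x \<in> space M"
    have "(SUP m. ennreal (- ln (c m x))) = ennreal (- ln (b x))"
    proof (rule antisym)
      show "(SUP m. ennreal (- ln (c m x))) \<le> ennreal (- ln (b x))"
        using b0[OF x] c(2) by (intro SUP_least ennreal_leI) (auto simp: c_def)
      \<comment> \<open>At each point the supremum is attained: once \<open>exp (- real m)\<close>
        is at most \<open>b x\<close>, truncation has no effect there.\<close>
      obtain m where "- ln (b x) \<le> real m" using real_arch_simple by blast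
      hence "exp (- real m) \<le> exp (ln (b x))" by simp
      hence "exp (- real m) \<le> b x" using b0[OF x] by simp
      hence "c m x = b x" by (simp add: c_def)
      thus "ennreal (- ln (b x)) \<le> (SUP m. ennreal (- ln (c m x)))"
        by (intro SUP_upper2[of m]) auto
    qed
    thus "e2ennreal (- eln (ereal (b x))) = (SUP m. ennreal (- ln (c m x)))"
      using b0[OF x] by (simp add: eln_ereal)
  qed
  also have "\<dots> = (SUP m. \<integral>\<^sup>+x. ennreal (- ln (c m x)) \<partial>M)"
  proof (rule nn_integral_monotone_convergence_SUP)
    show "incseq (\<lambda>m x. ennreal (- ln (c m x)))"
    proof (intro incseq_SucI le_funI ennreal_leI)
      fix m x
      have "c (Suc m) x \<le> c m x" unfolding c_def by (intro max.mono) auto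
      thus "- ln (c m x) \<le> - ln (c (Suc m) x)" using c(2) by simp
    qed
  qed measurable
  also have "\<dots> = (SUP m. ennreal (expectation (\<lambda>x. - ln (c m x))))"
    using lc intc by (intro SUP_cong refl nn_integral_eq_integral) auto
  finally have eq: "phi M b = enn2ereal (SUP m. ennreal (expectation (\<lambda>x. - ln (c m x))))"
    using b0 by (subst phi_eq_nn_integral) auto
  show "s \<le> lower_entropy \<I> M lam"
  proof (cases "s < 0")
    \<comment> \<open>As \<open>s\<close> may be minus infinity, a real \<open>t\<close> is inserted
      between \<open>s\<close> and 0; the truncation with \<open>m = 0\<close> suffices for it, its
      mean being nonnegative.\<close>
    case True
    then obtain t where t: "t < 0" "s \<le> ereal t"
      using ereal_dense2[OF True] by (auto intro: less_imp_le)
    have "0 \<le> expectation (\<lambda>x. - ln (c 0 x))" using lc by (intro Bochner_Integration.integral_nonneg) auto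
    hence "ereal t \<le> lower_entropy \<I> M lam"
      using t by (intro lower_entropy_ge[OF I cK[of 0] lam intc]) auto
    thus ?thesis using t by order
  next
    case False
    with s obtain t where t: "s = ereal t" "t \<ge> 0" by (cases s) auto
    have "ennreal t < (SUP m. ennreal (expectation (\<lambda>x. - ln (c m x))))"
      using s t unfolding eq by (simp add: less_ennreal.rep_eq)
    then obtain m where "ennreal t < ennreal (expectation (\<lambda>x. - ln (c m x)))"
      by (auto simp: less_SUP_iff)
    hence "t < expectation (\<lambda>x. - ln (c m x))" using t by (simp add: ennreal_less_iff)
    thus ?thesis unfolding t(1) by (intro lower_entropy_ge[OF I cK[of m] lam intc])
  qed
qed

section \<open>The upper bound\<close>

text \<open>Each step adds a set covering at least the fraction \<open>c\<close> of what is still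
  uncovered, so the remainder shrinks by the factor \<open>1 - c\<close>. The cardinality is only
  bounded by \<open>n\<close>, as a set may be chosen twice.\<close>

lemma (in finite_measure) greedy_cover:
  assumes G: "G \<in> sets M" and A: "\<A> \<subseteq> sets M" and c: "c \<le> 1"
    and step: "\<And>S. S \<in> sets M \<Longrightarrow> S \<subseteq> G \<Longrightarrow> \<exists>C\<in>\<A>. c * measure M S \<le> measure M (S \<inter> C)"
  shows "\<exists>B. finite B \<and> B \<subseteq> \<A> \<and> card B \<le> n \<and> measure M (G - \<Union>B) \<le> (1 - c) ^ n * measure M G"
proof (induction n)
  case 0
  show ?case by (rule exI[of _ "{}"]) simp
next
  case (Suc n)
  then obtain B where B: "finite B" "B \<subseteq> \<A>" "card B \<le> n"
    and m: "measure M (G - \<Union>B) \<le> (1 - c) ^ n * measure M G" by blast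
  have sB: "G - \<Union>B \<in> sets M" using B A G by (intro sets.Diff sets.finite_Union) auto
  then obtain C where C: "C \<in> \<A>" and mC: "c * measure M (G - \<Union>B) \<le> measure M ((G - \<Union>B) \<inter> C)"
    using step[of "G - \<Union>B"] by auto
  have sC: "C \<in> sets M" using C A by auto
  have "measure M (G - \<Union>(insert C B)) = measure M ((G - \<Union>B) - (G - \<Union>B) \<inter> C)"
    by (rule arg_cong[where f = "measure M"]) auto
  also have "\<dots> = measure M (G - \<Union>B) - measure M ((G - \<Union>B) \<inter> C)"
    using sB sC by (intro finite_measure_Diff) auto
  also have "\<dots> \<le> (1 - c) * measure M (G - \<Union>B)" using mC by (simp add: algebra_simps)
  also have "\<dots> \<le> (1 - c) * ((1 - c) ^ n * measure M G)" using m c by (intro mult_left_mono) auto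
  finally have "measure M (G - \<Union>(insert C B)) \<le> (1 - c) ^ Suc n * measure M G" by simp
  moreover have "card (insert C B) \<le> Suc n" using B by (auto simp: card_insert_if)
  ultimately show ?case using B C by (intro exI[of _ "insert C B"]) auto
qed

text \<open>First moment method: draw the coordinates of \<open>y\<close> independently from
  \<open>M1\<close>. By Fubini the expected measure of the part of \<open>S\<close> that is hit is
  the integral over \<open>S\<close> of the product of section measures, hence at least
  \<open>c * measure P2 S\<close>, and some \<open>y\<close> does no worse than the mean.\<close>

lemma (in pair_prob_space) exists_large_box:
  fixes l :: nat
  defines "P1 \<equiv> Pi\<^sub>M {..<l} (\<lambda>_. M1)" and "P2 \<equiv> Pi\<^sub>M {..<l} (\<lambda>_. M2)"
  assumes E[measurable]: "E \<in> sets (M1 \<Otimes>\<^sub>M M2)" and S[measurable]: "S \<in> sets P2"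
    and c: "0 \<le> c" "\<And>x. x \<in> S \<Longrightarrow> c \<le> (\<Prod>i<l. measure M1 ((\<lambda>y. (y, x i)) -` E))"
  shows "\<exists>y\<in>space P1. c * measure P2 S \<le> measure P2 (S \<inter> {x \<in> space P2. \<forall>i<l. (y i, x i) \<in> E})"
proof (rule ccontr)
  assume contra: "\<not> ?thesis"
  interpret P1: prob_space P1 unfolding P1_def by (rule M1.prob_space_PiM_const)
  interpret P2: prob_space P2 unfolding P2_def by (rule M2.prob_space_PiM_const)
  interpret P: pair_prob_space P1 P2 ..
  interpret F1: product_sigma_finite "\<lambda>_. M1" ..
  have space_E: "(y, x) \<in> E \<Longrightarrow> y \<in> space M1 \<and> x \<in> space M2" for x y
    using sets.sets_into_space[OF E] by (auto simp: space_pair_measure)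
  have [measurable]: "(\<lambda>z. (fst z i, snd z i)) \<in> P1 \<Otimes>\<^sub>M P2 \<rightarrow>\<^sub>M M1 \<Otimes>\<^sub>M M2" if "i < l" for i
    using that unfolding P1_def P2_def
    by (auto intro!: measurable_Pair measurable_compose[OF measurable_fst] measurable_compose[OF measurable_snd]
        measurable_component_singleton)
  define T where "T = {z \<in> space (P1 \<Otimes>\<^sub>M P2). snd z \<in> S \<and> (\<forall>i\<in>{..<l}. (fst z i, snd z i) \<in> E)}"
  have T[measurable]: "T \<in> sets (P1 \<Otimes>\<^sub>M P2)"
    unfolding T_def by measurable
  have [measurable]: "(\<lambda>y. measure P2 (Pair y -` T)) \<in> borel_measurable P1"
    unfolding measure_def using P2.measurable_emeasure_Pair[OF T] by measurable
  have sec2: "Pair y -` T = S \<inter> {x \<in> space P2. \<forall>i<l. (y i, x i) \<in> E}" if "y \<in> space P1" for y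
    using that by (auto simp: T_def space_pair_measure)
  have "ennreal (c * measure P2 S) = (\<integral>\<^sup>+x. ennreal c * indicator S x \<partial>P2)"
    using c(1) by (simp add: nn_integral_cmult_indicator P2.emeasure_eq_measure ennreal_mult')
  also have "\<dots> \<le> (\<integral>\<^sup>+x. emeasure P1 ((\<lambda>y. (y, x)) -` T) \<partial>P2)"
  proof (rule nn_integral_mono)
    fix x assume x: "x \<in> space P2"
    show "ennreal c * indicator S x \<le> emeasure P1 ((\<lambda>y. (y, x)) -` T)"
    proof (cases "x \<in> S")
      case True
      have "ennreal c \<le> ennreal (\<Prod>i<l. measure M1 ((\<lambda>y. (y, x i)) -` E))"
        using c(2)[OF True] by (rule ennreal_leI)
      also have "\<dots> = (\<Prod>i<l. emeasure M1 ((\<lambda>y. (y, x i)) -` E))"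
        by (simp add: prod_ennreal[symmetric] M1.emeasure_eq_measure)
      also have "\<dots> = emeasure P1 (Pi\<^sub>E {..<l} (\<lambda>i. (\<lambda>y. (y, x i)) -` E))"
        unfolding P1_def by (intro F1.emeasure_PiM[symmetric] sets_Pair2[OF E]) simp
      \<comment> \<open>For fixed \<open>x\<close> in \<open>S\<close> the conditions on the
        coordinates of \<open>y\<close> are separate, so the section of \<open>T\<close> is a
        product set.\<close>
      also have "Pi\<^sub>E {..<l} (\<lambda>i. (\<lambda>y. (y, x i)) -` E) = (\<lambda>y. (y, x)) -` T"
        using x True space_E by (auto simp: T_def space_pair_measure P1_def space_PiM PiE_def extensional_def)
      finally show ?thesis using True by simp
    qed simp
  qed
  also have "\<dots> = emeasure (P1 \<Otimes>\<^sub>M P2) T" by (rule P.emeasure_pair_measure_alt2[OF T, symmetric])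
  also have "\<dots> = (\<integral>\<^sup>+y. emeasure P2 (Pair y -` T) \<partial>P1)" by (rule P2.emeasure_pair_measure_alt[OF T])
  also have "\<dots> = ennreal (P1.expectation (\<lambda>y. measure P2 (Pair y -` T)))"
    unfolding P2.emeasure_eq_measure
    by (intro nn_integral_eq_integral P1.integrable_const_bound[where B = 1]) auto
  finally have "c * measure P2 S \<le> P1.expectation (\<lambda>y. measure P2 (Pair y -` T))"
    by (subst (asm) ennreal_le_iff) (auto intro!: Bochner_Integration.integral_nonneg)
  \<comment> \<open>If every \<open>y\<close> falls strictly short, so does the mean, because
    \<open>P1\<close> has total mass 1.\<close>
  moreover have "P1.expectation (\<lambda>y. measure P2 (Pair y -` T)) < c * measure P2 S"
  proof (rule P1.expectation_less)
    show "integrable P1 (\<lambda>y. measure P2 (Pair y -` T))"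
      by (intro P1.integrable_const_bound[where B = 1]) auto
    show "AE y in P1. measure P2 (Pair y -` T) < c * measure P2 S"
      using contra by (intro AE_I2) (auto simp: sec2 not_le)
  qed
  ultimately show False by simp
qed

text \<open>The set \<open>E\<close> is a measurable part of the incidence relation, so replacing
  sections of \<open>E\<close> by actual boxes only enlarges what is covered. Random boxes supply
  the greedy step with \<open>c = exp (- (real l * t))\<close> on a set \<open>G\<close> of measure
  above \<open>1 - lam / 2\<close>.\<close>

lemma upper_entropy_le:
  assumes I: "\<I> \<subseteq> sets M" and M: "prob_space M" and N: "prob_space N"
    and lam: "0 < lam" "lam < 1"
    and space: "space N = \<I>"
    and E: "E \<in> sets (N \<Otimes>\<^sub>M M)" "\<And>J x. (J, x) \<in> E \<Longrightarrow> x \<in> J"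
    and a_def: "\<And>x. a x = measure N ((\<lambda>J. (J, x)) -` E)"
    and pos: "AE x in M. 0 < a x"
    and int: "integrable M (\<lambda>x. ln (a x))" and t: "(\<integral>x. - ln (a x) \<partial>M) < t"
  shows "upper_entropy \<I> M lam \<le> ereal t"
proof -
  interpret M: prob_space M by fact
  interpret N: prob_space N by fact
  interpret NM: pair_prob_space N M ..
  have a01: "0 \<le> a x" "a x \<le> 1" for x by (auto simp: a_def)
  have "ln (a x) \<le> 0" for x using a01[of x] by (cases "a x = 0") auto
  hence "0 \<le> (\<integral>x. - ln (a x) \<partial>M)" by (intro Bochner_Integration.integral_nonneg) auto
  with t have t0: "0 < t" by simp
  have a_meas[measurable]: "a \<in> borel_measurable M"
    unfolding a_def[abs_def] measure_def using NM.measurable_emeasure_Pair2[OF E(1)] by measurable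
  \<comment> \<open>Chosen so that about \<open>k * exp (real l * t)\<close> greedy steps leave at
    most \<open>exp (- k) = lam / 2\<close> of \<open>G\<close> uncovered.\<close>
  define k where "k = ln (2 / lam)"
  have k: "0 < k" "exp (- k) = lam / 2" using lam by (auto simp: k_def exp_minus)
  have "(\<lambda>l. measure (Pi\<^sub>M {..<l} (\<lambda>_. M))
      {x \<in> space (Pi\<^sub>M {..<l} (\<lambda>_. M)). real l * t \<le> (\<Sum>i<l. - ln (a (x i)))}) \<longlonglongrightarrow> 0"
    using t int by (intro M.upper_tail_tendsto_0) auto
  hence "\<forall>\<^sub>F l in sequentially. measure (Pi\<^sub>M {..<l} (\<lambda>_. M))
      {x \<in> space (Pi\<^sub>M {..<l} (\<lambda>_. M)). real l * t \<le> (\<Sum>i<l. - ln (a (x i)))} < lam / 2"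
    using lam by (intro order_tendstoD(2)) auto
  hence "\<forall>\<^sub>F l in sequentially. ereal (1 / real l) * eln (ereal_of_enat (cover_number \<I> M lam l))
     \<le> ereal (t + ln (k + 1) / real l)"
    using eventually_gt_at_top[of 0]
  proof eventually_elim
    case (elim l)
    define P where "P = Pi\<^sub>M {..<l} (\<lambda>_. M)"
    interpret P: prob_space P unfolding P_def by (rule M.prob_space_PiM_const)
    have ma[measurable]: "(\<lambda>x. a (x i)) \<in> borel_measurable P" if "i \<in> {..<l}" for i
      using that unfolding P_def by (auto intro!: measurable_compose[OF measurable_component_singleton])
    have [measurable]: "(\<lambda>x. \<Sum>i<l. - ln (a (x i))) \<in> borel_measurable P"
      using ma by (auto intro!: borel_measurable_sum borel_measurable_ln)
    \<comment> \<open>Positivity is required separately: with \<open>ln 0 = 0\<close>, a vanishing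
      factor would not show in the sum.\<close>
    define G where "G = {x \<in> space P. (\<forall>i\<in>{..<l}. 0 < a (x i)) \<and> (\<Sum>i<l. - ln (a (x i))) < real l * t}"
    have G[measurable]: "G \<in> sets P" unfolding G_def by measurable
    have "AE x in P. \<forall>i\<in>{..<l}. 0 < a (x i)"
      unfolding P_def by (intro AE_finite_allI AE_PiM_component[OF M _ pos]) auto
    hence "P.prob (space P - G) \<le> P.prob {x \<in> space P. real l * t \<le> (\<Sum>i<l. - ln (a (x i)))}"
      by (intro P.finite_measure_mono_AE) (auto simp: G_def elim!: eventually_mono)
    also have "\<dots> < lam / 2" using elim by (simp add: P_def)
    finally have probG: "1 - lam / 2 < P.prob G" by (simp add: P.prob_compl)
    define c where "c = exp (- (real l * t))"
    have c: "0 < c" "c \<le> 1" using t0 by (auto simp: c_def)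
    have prod: "c \<le> (\<Prod>i<l. a (x i))" if "x \<in> G" for x
    proof -
      have "c \<le> exp (\<Sum>i<l. ln (a (x i)))" using that by (auto simp: c_def G_def sum_negf)
      also have "\<dots> = (\<Prod>i<l. a (x i))"
        unfolding exp_sum[OF finite_lessThan] using that by (intro prod.cong) (auto simp: G_def)
      finally show ?thesis .
    qed
    define n where "n = nat \<lceil>k * exp (real l * t)\<rceil>"
    have n: "k * exp (real l * t) \<le> real n" "real n \<le> k * exp (real l * t) + 1"
      using k by (auto simp: n_def)
    have "\<exists>B. finite B \<and> B \<subseteq> boxes \<I> l \<and> card B \<le> n \<and> P.prob (G - \<Union>B) \<le> (1 - c) ^ n * P.prob G"
    proof (rule P.greedy_cover[OF G _ c(2)])
      show "boxes \<I> l \<subseteq> sets P" unfolding P_def using boxes_measurable[OF I, of _ l] by auto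
      fix S assume S: "S \<in> sets P" "S \<subseteq> G"
      have "\<exists>J\<in>space (Pi\<^sub>M {..<l} (\<lambda>_. N)). c * P.prob S \<le> P.prob (S \<inter> {x \<in> space P. \<forall>i<l. (J i, x i) \<in> E})"
        unfolding P_def using S prod c(1)
        by (intro NM.exists_large_box E) (auto simp: P_def a_def[symmetric])
      then obtain J where J: "J \<in> space (Pi\<^sub>M {..<l} (\<lambda>_. N))"
        and "c * P.prob S \<le> P.prob (S \<inter> {x \<in> space P. \<forall>i<l. (J i, x i) \<in> E})" by blast
      note this(2)
      also have "P.prob (S \<inter> {x \<in> space P. \<forall>i<l. (J i, x i) \<in> E}) \<le> P.prob (S \<inter> Pi\<^sub>E {..<l} J)"
      proof (rule P.finite_measure_mono)
        show "S \<inter> {x \<in> space P. \<forall>i<l. (J i, x i) \<in> E} \<subseteq> S \<inter> Pi\<^sub>E {..<l} J"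
          using E(2) by (auto simp: P_def space_PiM PiE_def extensional_def)
        show "S \<inter> Pi\<^sub>E {..<l} J \<in> sets P"
          using S J I space unfolding P_def by (intro sets.Int sets_PiM_I_finite) (auto simp: space_PiM)
      qed
      finally show "\<exists>C\<in>boxes \<I> l. c * P.prob S \<le> P.prob (S \<inter> C)"
        using J space by (intro bexI[of _ "Pi\<^sub>E {..<l} J"]) (auto simp: boxes_def space_PiM)
    qed
    then obtain B where B: "finite B" "B \<subseteq> boxes \<I> l" "card B \<le> n"
      and mB: "P.prob (G - \<Union>B) \<le> (1 - c) ^ n * P.prob G" by blast
    have sB: "\<Union>B \<in> sets P"
      unfolding P_def using B boxes_measurable[OF I, of _ l] by (intro sets.finite_Union) auto
    \<comment> \<open>The remainder is estimated by \<open>1 - c \<le> exp (- c)\<close> together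
      with \<open>c * real n \<ge> k\<close>.\<close>
    have "(1 - c) ^ n * P.prob G \<le> (1 - c) ^ n" using c by (intro mult_left_le) auto
    also have "\<dots> \<le> exp (- c) ^ n" using c exp_ge_add_one_self[of "- c"] by (intro power_mono) auto
    also have "\<dots> = exp (- (c * real n))" by (simp add: exp_of_nat_mult[symmetric] mult.commute)
    also have "\<dots> \<le> exp (- k)"
    proof -
      have "k = c * (k * exp (real l * t))" by (simp add: c_def exp_minus)
      also have "\<dots> \<le> c * real n" using n(1) c by (intro mult_left_mono) auto
      finally show ?thesis by simp
    qed
    finally have "P.prob (G - \<Union>B) \<le> lam / 2" using mB k by simp
    \<comment> \<open>The error budget \<open>lam\<close> is split evenly between the complement of
      \<open>G\<close> and the uncovered part of \<open>G\<close>.\<close>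
    moreover have "P.prob G \<le> P.prob (\<Union>B) + P.prob (G - \<Union>B)"
      using sB G by (subst P.finite_measure_Union[symmetric]) (auto intro!: P.finite_measure_mono)
    ultimately have cov: "1 - lam \<le> P.prob (\<Union>B)" using probG by simp
    show ?case
    proof (rule entropy_rate_le)
      \<comment> \<open>The 1 lost in rounding \<open>n\<close> up is absorbed into the constant,
        which becomes \<open>k + 1\<close>.\<close>
      have "1 \<le> exp (real l * t)" using t0 by simp
      hence "real n \<le> (k + 1) * exp (real l * t)" using n(2) unfolding distrib_right by linarith
      thus "real (card B) \<le> (k + 1) * exp (real l * t)" using B(3) by linarith
    qed (use elim k B cov in \<open>auto simp: P_def\<close>)
  qed
  hence "upper_entropy \<I> M lam \<le> limsup (\<lambda>l. ereal (t + ln (k + 1) / real l))"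
    unfolding upper_entropy_def by (rule Limsup_mono)
  thus ?thesis
    using lim_imp_Limsup[OF sequentially_bot tendsto_add_const_over] by simp
qed

section \<open>From the completed product to measurable sections\<close>

text \<open>A set of the completion is a measurable \<open>E\<close> together with a part of a null
  set \<open>N'\<close>. By Fubini almost every section of \<open>N'\<close> is null, so for almost
  every \<open>x\<close> the sections of the incidence set and of \<open>E\<close> have the same
  measure.\<close>

lemma compatible_inner_approximation:
  assumes "prob_space M" and comp: "compatible \<I> M \<beta>"
  obtains E where "E \<in> sets (\<beta> \<Otimes>\<^sub>M M)" "\<And>J x. (J, x) \<in> E \<Longrightarrow> x \<in> J"
    "AE x in M. (\<integral>J. indicator J x \<partial>(completion \<beta>)) = measure \<beta> ((\<lambda>J. (J, x)) -` E)"
proof -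
  interpret M: prob_space M by fact
  interpret b: prob_space \<beta> using comp by (simp add: compatible_def)
  interpret P: pair_prob_space \<beta> M ..
  have space: "space \<beta> = \<I>" using comp by (simp add: compatible_def)
  obtain E N N' where E: "{(J, x). J \<in> \<I> \<and> x \<in> space M \<and> x \<in> J} = E \<union> N" "N \<subseteq> N'"
    and N': "N' \<in> null_sets (\<beta> \<Otimes>\<^sub>M M)" and sE: "E \<in> sets (\<beta> \<Otimes>\<^sub>M M)"
    using comp by (auto simp: compatible_def elim!: sets_completionE)
  have sN': "N' \<in> sets (\<beta> \<Otimes>\<^sub>M M)" using N' by auto
  have "(\<integral>\<^sup>+x. emeasure \<beta> ((\<lambda>J. (J, x)) -` N') \<partial>M) = 0"
    using N' P.emeasure_pair_measure_alt2[OF sN'] by auto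
  hence "AE x in M. emeasure \<beta> ((\<lambda>J. (J, x)) -` N') = 0"
    using nn_integral_0_iff_AE[OF P.measurable_emeasure_Pair2[OF sN']] by simp
  moreover have "AE x in M. x \<in> space M" by simp
  ultimately have AE: "AE x in M. (\<integral>J. indicator J x \<partial>(completion \<beta>)) = measure \<beta> ((\<lambda>J. (J, x)) -` E)"
  proof eventually_elim
    case (elim x)
    let ?s = "\<lambda>A. (\<lambda>J. (J, x)) -` A"
    have sec: "{J \<in> \<I>. x \<in> J} = ?s E \<union> ?s N" "?s N \<subseteq> ?s N'" using E elim(2) by auto
    have null: "?s N' \<in> null_sets \<beta>" using elim(1) sets_Pair2[OF sN'] by auto
    have "?s E \<in> sets \<beta>" using sets_Pair2[OF sE] .
    \<comment> \<open>For such \<open>x\<close> the integrand is measurable for the completion, so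
      the integral is a genuine one and not the default value 0.\<close>
    hence set: "{J \<in> \<I>. x \<in> J} \<in> sets (completion \<beta>)"
      using sec null by (rule sets_completionI[rotated 3])
    have "(\<integral>J. indicator J x \<partial>(completion \<beta>)) = (\<integral>J. indicat_real {J \<in> \<I>. x \<in> J} J \<partial>completion \<beta>)"
      by (intro Bochner_Integration.integral_cong) (auto simp: space indicator_def)
    also have "\<dots> = (\<integral>J. indicator (?s E) J \<partial>(completion \<beta>))"
    proof (rule integral_cong_AE)
      have "AE J in \<beta>. J \<notin> ?s N'" using null by (rule AE_not_in)
      hence "AE J in \<beta>. (indicator {J \<in> \<I>. x \<in> J} J :: real) = indicator (?s E) J"
        using sec by (auto simp: indicator_def elim!: eventually_mono)
      thus "AE J in completion \<beta>. (indicator {J \<in> \<I>. x \<in> J} J :: real) = indicator (?s E) J"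
        by (rule AE_completion)
    qed (use set \<open>?s E \<in> sets \<beta>\<close> in \<open>auto intro!: borel_measurable_indicator\<close>)
    also have "\<dots> = (\<integral>J. indicator (?s E) J \<partial>\<beta>)"
      using \<open>?s E \<in> sets \<beta>\<close> by (intro integral_completion) auto
    also have "\<dots> = measure \<beta> (?s E)"
      using \<open>?s E \<in> sets \<beta>\<close> by simp
    finally show ?case .
  qed
  show ?thesis
  proof (rule that[OF sE _ AE])
    fix J x assume "(J, x) \<in> E"
    hence "(J, x) \<in> {(J, x). J \<in> \<I> \<and> x \<in> space M \<and> x \<in> J}" using E by blast
    thus "x \<in> J" by simp
  qed
qed

text \<open>The function \<open>f\<close> agrees almost everywhere with the measurable section
  function \<open>a\<close>, and \<open>phi\<close> does not see the difference. If
  \<open>phi M f\<close> is finite, then \<open>a\<close> is almost everywhere positive with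
  integrable logarithm, which is what the covering argument requires.\<close>

lemma upper_entropy_le_H_full:
  assumes I: "\<I> \<subseteq> sets M" and M: "prob_space M" and lam: "0 < lam" "lam < 1"
  shows "upper_entropy \<I> M lam \<le> H_full \<I> M"
  unfolding H_full_def
proof (rule INF_greatest, rule dense_ge)
  fix f s assume "f \<in> VP_full \<I> M" and s: "phi M f < s"
  then obtain \<beta> where comp: "compatible \<I> M \<beta>" and f: "f = (\<lambda>x. \<integral>J. indicator J x \<partial>(completion \<beta>))"
    by (auto simp: VP_full_def)
  obtain E where E: "E \<in> sets (\<beta> \<Otimes>\<^sub>M M)" "\<And>J x. (J, x) \<in> E \<Longrightarrow> x \<in> J"
    and AE: "AE x in M. f x = measure \<beta> ((\<lambda>J. (J, x)) -` E)"
    using compatible_inner_approximation[OF M comp, folded fun_cong[OF f]] that by blast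
  interpret M: prob_space M by fact
  interpret b: prob_space \<beta> using comp by (simp add: compatible_def)
  interpret P: pair_prob_space \<beta> M ..
  define a where "a x = measure \<beta> ((\<lambda>J. (J, x)) -` E)" for x
  have [measurable]: "a \<in> borel_measurable M"
    unfolding a_def[abs_def] measure_def using P.measurable_emeasure_Pair2[OF E(1)] by measurable
  have a01: "0 \<le> a x" "a x \<le> 1" for x by (auto simp: a_def)
  have ln0: "ln (a x) \<le> 0" for x using a01[of x] by (cases "a x = 0") auto
  have eln_a: "e2ennreal (- eln (ereal (a x))) = (if a x = 0 then \<infinity> else ennreal (- ln (a x)))" for x
    using a01(1)[of x] by (auto simp: eln_def)
  define I where "I = (\<integral>\<^sup>+x. e2ennreal (- eln (ereal (a x))) \<partial>M)"
  have "AE x in M. f x \<le> 1" using AE a01(2) by (auto simp: a_def elim!: eventually_mono)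
  hence "phi M f = enn2ereal (\<integral>\<^sup>+x. e2ennreal (- eln (ereal (f x))) \<partial>M)"
    by (rule phi_eq_nn_integral)
  also have "(\<integral>\<^sup>+x. e2ennreal (- eln (ereal (f x))) \<partial>M) = I"
    unfolding I_def using AE by (intro nn_integral_cong_AE) (auto simp: a_def elim!: eventually_mono)
  finally have phi: "phi M f = enn2ereal I" .
  show "upper_entropy \<I> M lam \<le> s"
  proof (cases "s = \<infinity>")
    case False
    have "0 < s" using s by (simp add: phi) (metis enn2ereal_nonneg order_le_less_trans)
    with False obtain t where t: "s = ereal t" "0 < t" by (cases s) auto
    have It: "I < ennreal t" using s t by (simp add: phi less_ennreal.rep_eq)
    hence "I \<noteq> \<infinity>" by auto
    \<comment> \<open>A zero of \<open>a\<close> makes the integrand infinite, so a finite integral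
      allows zeros only on a null set.\<close>
    hence "AE x in M. e2ennreal (- eln (ereal (a x))) \<noteq> \<infinity>"
      unfolding I_def eln_a by (intro nn_integral_PInf_AE) auto
    hence pos: "AE x in M. 0 < a x"
    proof eventually_elim
      case (elim x)
      thus ?case using a01(1)[of x] by (auto simp: eln_a split: if_splits)
    qed
    have I: "I = (\<integral>\<^sup>+x. ennreal (- ln (a x)) \<partial>M)"
      unfolding I_def eln_a using pos by (intro nn_integral_cong_AE) (auto elim!: eventually_mono)
    have "integrable M (\<lambda>x. - ln (a x))"
      using ln0 It by (intro integrableI_nonneg) (auto simp: I top.not_eq_extremum intro: less_trans)
    hence int: "integrable M (\<lambda>x. ln (a x))" by simp
    have "ennreal (\<integral>x. - ln (a x) \<partial>M) < ennreal t"
      using It int ln0 unfolding I by (subst (asm) nn_integral_eq_integral) auto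
    moreover have "0 \<le> (\<integral>x. - ln (a x) \<partial>M)"
      using ln0 by (intro Bochner_Integration.integral_nonneg) auto
    ultimately have "(\<integral>x. - ln (a x) \<partial>M) < t" by (subst (asm) ennreal_less_iff)
    thus ?thesis
      unfolding t(1) using comp
      by (intro upper_entropy_le[OF assms(1) M _ lam _ E a_def pos int]) (auto simp: compatible_def)
  qed simp
qed

section \<open>Discrete combinations\<close>

text \<open>Take for \<open>\<beta>\<close> the law of \<open>J k\<close> with \<open>k\<close>
  drawn with weights \<open>q\<close>, on all subsets of \<open>\<I>\<close>. Only the countably
  many sets in \<open>range J\<close> carry mass: over these the incidence set is a countable union
  of rectangles, and the rest lies in a null set, so the completion makes \<open>\<beta>\<close>
  compatible.\<close>

lemma VP_cnt_subset_VP_full: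
  assumes M: "prob_space M" and I: "\<I> \<subseteq> sets M"
  shows "VP_cnt \<I> \<subseteq> VP_full \<I> M"
proof
  fix a assume "a \<in> VP_cnt \<I>"
  then obtain q :: "nat \<Rightarrow> real" and J where a: "a = (\<lambda>x. \<Sum>k. q k * indicator (J k) x)"
    and J: "\<And>k. J k \<in> \<I>" and q: "\<And>k. 0 \<le> q k" "q sums 1"
    by (auto simp: VP_cnt_def)
  have "(\<integral>\<^sup>+k. ennreal (q k) \<partial>count_space UNIV) = (\<Sum>k. ennreal (q k))"
    by (rule nn_integral_count_space_nat)
  also have "\<dots> = 1" using q by (simp add: suminf_ennreal2 sums_iff)
  finally have pmf: "pmf (embed_pmf q) k = q k" for k
    using q(1) by (intro pmf_embed_pmf)
  define \<beta> where "\<beta> = distr (embed_pmf q) (count_space \<I>) J"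
  have mJ: "J \<in> measure_pmf (embed_pmf q) \<rightarrow>\<^sub>M count_space \<I>" using J by auto
  interpret M: prob_space M by fact
  interpret b: prob_space \<beta> unfolding \<beta>_def by (rule measure_pmf.prob_space_distr[OF mJ])
  have space: "space \<beta> = \<I>" and sets: "sets \<beta> = Pow \<I>" by (auto simp: \<beta>_def)
  have "J -` (\<I> - range J) = {}" by auto
  hence "emeasure \<beta> (\<I> - range J) = 0"
    unfolding \<beta>_def by (subst emeasure_distr[OF mJ]) simp_all
  hence null: "(\<I> - range J) \<times> space M \<in> null_sets (\<beta> \<Otimes>\<^sub>M M)"
    by (intro null_setsI) (auto simp: M.emeasure_pair_measure_Times sets)
  have "{J k} \<times> J k \<in> sets (\<beta> \<Otimes>\<^sub>M M)" for k
    using J[of k] I by (intro pair_measureI) (auto simp: sets)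
  hence "(\<Union>k. {J k} \<times> J k) \<in> sets (\<beta> \<Otimes>\<^sub>M M)" by auto
  moreover have "{(K, x). K \<in> \<I> \<and> x \<in> space M \<and> x \<in> K} =
      (\<Union>k. {J k} \<times> J k) \<union> {(K, x). K \<in> \<I> - range J \<and> x \<in> space M \<and> x \<in> K}"
    using J I sets.sets_into_space[of _ M] by fast
  ultimately have "{(K, x). K \<in> \<I> \<and> x \<in> space M \<and> x \<in> K} \<in> sets (completion (\<beta> \<Otimes>\<^sub>M M))"
    using null by (intro sets_completionI) auto
  hence "compatible \<I> M \<beta>"
    by (simp add: compatible_def space b.prob_space_axioms)
  moreover have "a = (\<lambda>x. \<integral>K. indicator K x \<partial>(completion \<beta>))"
  proof
    fix x
    have m: "(\<lambda>K. indicator K x :: real) \<in> borel_measurable \<beta>"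
      by (simp add: \<beta>_def)
    have "(\<integral>K. indicator K x \<partial>(completion \<beta>)) = (\<integral>K. indicat_real K x \<partial>\<beta>)"
      by (rule integral_completion[OF m])
    also have "\<dots> = (\<integral>k. indicator (J k) x \<partial>measure_pmf (embed_pmf q))"
      unfolding \<beta>_def by (intro integral_distr mJ) simp
    also have "\<dots> = (\<integral>k. q k * indicator (J k) x \<partial>count_space UNIV)"
      unfolding measure_pmf_eq_density by (subst integral_density) (auto simp: pmf q(1))
    also have "\<dots> = a x"
    proof -
      \<comment> \<open>Absolute summability, by comparison with \<open>q\<close>, identifies the
        integral over the counting measure with the series.\<close>
      have "summable (\<lambda>k. norm (q k * indicator (J k) x))"
      proof (rule summable_comparison_test')
        show "summable q" using q(2) by (rule sums_summable)
        show "norm (norm (q k * indicator (J k) x)) \<le> q k" for k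
          using q(1)[of k] by (simp add: indicator_def)
      qed
      thus ?thesis unfolding a by (intro integral_count_space_nat) (simp add: integrable_count_space_nat_iff)
    qed
    finally show "a x = (\<integral>K. indicator K x \<partial>(completion \<beta>))" ..
  qed
  ultimately show "a \<in> VP_full \<I> M"
    unfolding VP_full_def by blast
qed

lemma VP_subset_VP_cnt: "VP \<I> \<subseteq> VP_cnt \<I>"
proof
  fix a assume "a \<in> VP \<I>"
  then obtain n :: nat and q J where a: "a = (\<lambda>x. \<Sum>k<n. q k * indicator (J k) x)"
    and J: "\<And>k. k < n \<Longrightarrow> J k \<in> \<I> \<and> 0 \<le> q k" and q: "(\<Sum>k<n. q k) = (1 :: real)"
    by (auto simp: VP_def)
  have "0 < n" using q by (cases n) auto
  \<comment> \<open>The padding needs some member of \<open>\<I>\<close>; \<open>J 0\<close> is one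
    because \<open>n > 0\<close>, an empty sum not being 1.\<close>
  define q' J' where "q' k = (if k < n then q k else 0)" and "J' k = (if k < n then J k else J 0)" for k
  have "a x = (\<Sum>k. q' k * indicator (J' k) x)" for x
    unfolding a by (subst suminf_finite[of "{..<n}"]) (auto simp: q'_def J'_def)
  moreover have "q' sums 1"
    using sums_finite[of "{..<n}" q'] q by (auto simp: q'_def)
  ultimately show "a \<in> VP_cnt \<I>"
    unfolding VP_cnt_def using J \<open>0 < n\<close>
    by (intro CollectI exI[of _ q'] exI[of _ J']) (auto simp: q'_def J'_def fun_eq_iff)
qed

theorem theorem2p10:
  fixes M :: "'a measure" and \<I> :: "'a set set" and lam :: real
  assumes "prob_space M" and "\<I> \<subseteq> sets M" and "0 < lam" and "lam < 1"
  shows "H_lower \<I> M \<le> lower_entropy \<I> M lam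
       \<and> lower_entropy \<I> M lam \<le> upper_entropy \<I> M lam
       \<and> upper_entropy \<I> M lam \<le> H_full \<I> M
       \<and> H_full \<I> M \<le> H_cnt \<I> M
       \<and> H_cnt \<I> M \<le> H_fin \<I> M"
proof (intro conjI)
  show "H_lower \<I> M \<le> lower_entropy \<I> M lam"
    using assms by (intro prob_space.H_lower_le_lower_entropy)
  show "lower_entropy \<I> M lam \<le> upper_entropy \<I> M lam"
    unfolding lower_entropy_def upper_entropy_def by (intro Liminf_le_Limsup) simp
  show "upper_entropy \<I> M lam \<le> H_full \<I> M"
    using assms by (intro upper_entropy_le_H_full)
  show "H_full \<I> M \<le> H_cnt \<I> M"
    unfolding H_full_def H_cnt_def using VP_cnt_subset_VP_full[OF assms(1,2)] by (intro INF_superset_mono) auto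
  show "H_cnt \<I> M \<le> H_fin \<I> M"
    unfolding H_cnt_def H_fin_def using VP_subset_VP_cnt by (intro INF_superset_mono) auto
qed

end
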